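(* If $n\ge 2$ and $r\ge 1$ are integers, then $$\eta_{dl}(K_n\circ \overline{K_r}) = \left\lceil \frac{n+r}{r+1}\right\rceil\,.$$
   Context: For graphs $G$ with $V(G)=\{1,\dots,n\}$ and $H$, the corona $G\circ H$ is obtained from the disjoint union of $G$ and $n$ disjoint copies $H_1,\dots,H_n$ of $H$ by joining vertex $i\in V(G)$ by an edge to every vertex of $H_i$. $\overline{K_r}$ is the edgeless graph on $r$ vertices, so $K_n\circ\overline{K_r}$ is $K_n$ with $r$ pendant vertices attached to each vertex. For a graph $G$, $N(u)$ is the open neighborhood and $d_G(u)$ the degree of $u$. Given a vertex labeling $\ell: V(G)\to \mathbb{N}$ (positive integers), the $d$-lucky sum of $u$ is $d_\ell(u) = d_G(u) + \sum_{v\in N(u)}\ell(v)$; $\ell$ is a $d$-lucky labeling if $d_\ell(u)\neq d_\ell(v)$ for every edge $uv$. The $d$-lucky number $\eta_{dl}(G)$ is the least positive integer $k$ such that $G$ admits a $d$-lucky labeling $V(G)\to\{1,\dots,k\}$. *)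

theory Defs
  imports Complex_Main "Graph_Theory.Graph_Theory"
begin

text \<open>
  Finite simple graphs are represented, as in the Graph\_Theory entry, by finite symmetric
  loop-free digraphs without parallel arcs (locales \<open>graph\<close> and \<open>pair_graph\<close>): an edge \<open>uv\<close> is the
  pair of arcs \<open>(u, v)\<close>, \<open>(v, u)\<close>. The degree of a vertex is therefore its \<open>out_degree\<close>.
\<close>

definition edgeless_digraph :: "nat \<Rightarrow> ('a, 'b) pre_digraph \<Rightarrow> bool" where
  "edgeless_digraph r H \<longleftrightarrow> graph H \<and> card (verts H) = r \<and> arcs H = {}"

text \<open>
  In the corona, \<open>Inl i\<close> is the vertex \<open>i\<close> of \<open>G\<close>, and \<open>Inr (i, x)\<close> is the vertex \<open>x\<close> in the copy of \<open>H\<close>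
  belonging to \<open>i\<close>.
\<close>

definition corona :: "'a pair_pre_digraph \<Rightarrow> 'b pair_pre_digraph \<Rightarrow> ('a + 'a \<times> 'b) pair_pre_digraph"
  where
  "corona G H =
    \<lparr> pverts = Inl ` pverts G \<union> Inr ` (pverts G \<times> pverts H),
      parcs = {(Inl i, Inl j) | i j. (i, j) \<in> parcs G}
        \<union> {(Inr (i, x), Inr (i, y)) | i x y. i \<in> pverts G \<and> (x, y) \<in> parcs H}
        \<union> {(Inl i, Inr (i, x)) | i x. i \<in> pverts G \<and> x \<in> pverts H}
        \<union> {(Inr (i, x), Inl i) | i x. i \<in> pverts G \<and> x \<in> pverts H} \<rparr>"

definition neighborhood :: "('a, 'b) pre_digraph \<Rightarrow> 'a \<Rightarrow> 'a set" where
  "neighborhood G u = {v. u \<rightarrow>\<^bsub>G\<^esub> v}"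

definition d_lucky_sum :: "('a, 'b) pre_digraph \<Rightarrow> ('a \<Rightarrow> nat) \<Rightarrow> 'a \<Rightarrow> nat" where
  "d_lucky_sum G l u = out_degree G u + (\<Sum>v\<in>neighborhood G u. l v)"

definition d_lucky_labeling :: "('a, 'b) pre_digraph \<Rightarrow> ('a \<Rightarrow> nat) \<Rightarrow> bool" where
  "d_lucky_labeling G l \<longleftrightarrow>
    (\<forall>v\<in>verts G. l v > 0) \<and>
    (\<forall>u v. u \<rightarrow>\<^bsub>G\<^esub> v \<longrightarrow> d_lucky_sum G l u \<noteq> d_lucky_sum G l v)"

definition d_lucky_number :: "('a, 'b) pre_digraph \<Rightarrow> nat" where
  "d_lucky_number G =
    (LEAST k. k > 0 \<and> (\<exists>l. l ` verts G \<subseteq> {1..k} \<and> d_lucky_labeling G l))"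

lemma pair_graph_corona:
  assumes "pair_graph G" "pair_graph H"
  shows "pair_graph (corona G H)"
proof -
  interpret G: pair_graph G by fact
  interpret H: pair_graph H by fact
  have sG: "(j, i) \<in> parcs G" if "(i, j) \<in> parcs G" for i j
    using G.pair_sym_arcs that by (auto simp: symmetric_def dest: symD)
  have sH: "(j, i) \<in> parcs H" if "(i, j) \<in> parcs H" for i j
    using H.pair_sym_arcs that by (auto simp: symmetric_def dest: symD)
  have fin: "finite (pverts (corona G H))"
    using G.pair_finite_verts H.pair_finite_verts by (simp add: corona_def)
  have sub: "parcs (corona G H) \<subseteq> pverts (corona G H) \<times> pverts (corona G H)"
    by (auto simp: corona_def dest: G.in_arcsD1 G.in_arcsD2 H.in_arcsD1 H.in_arcsD2)
  have sym: "sym (parcs (corona G H))"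
    by (rule symI) (auto simp: corona_def intro: sG sH)
  have loop: "fst e \<noteq> snd e" if "e \<in> parcs (corona G H)" for e
    using that by (auto simp: corona_def dest: G.pair_no_loops H.pair_no_loops)
  show ?thesis
    using fin sub sym loop finite_subset[OF sub]
    by unfold_locales (auto simp: symmetric_def)
qed

lemma ex_complete_digraph: "\<exists>G :: nat pair_pre_digraph. K\<^bsub>n\<^esub> (with_proj G)"
  by (rule exI[of _ "\<lparr> pverts = {1..n}, parcs = {(i, j) \<in> {1..n} \<times> {1..n}. i \<noteq> j} \<rparr>"])
    (auto simp: complete_digraph_pair_def)

lemma ex_edgeless_digraph: "\<exists>H :: nat pair_pre_digraph. edgeless_digraph r (with_proj H)"
proof -
  let ?H = "\<lparr> pverts = {1..r}, parcs = {} \<rparr>"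
  interpret pair_graph ?H by unfold_locales (auto simp: symmetric_def sym_def)
  have "graph (with_proj ?H)" by (rule pair_graphD_graph)
  then show ?thesis by (auto simp: edgeless_digraph_def intro!: exI[of _ ?H])
qed

end

theory Submission
  imports Defs
begin

text \<open>
  Let \<open>V\<close> be the vertex set of \<open>K\<^sub>n\<close>, let \<open>S\<close> be the total label of \<open>V\<close>, and let \<open>p i\<close> be the total
  label of the pendants at \<open>i\<close>. The sum at \<open>i\<close> is \<open>n - 1 + r + S - l i + p i\<close>, and at a pendant of
  \<open>i\<close> it is \<open>1 + l i\<close>. So adjacency inside \<open>K\<^sub>n\<close> demands that the \<open>n\<close> numbers \<open>p i - l i\<close> be distinct;
  with labels in \<open>{1..k}\<close> they can be any of the \<open>(r + 1) (k - 1) + 1\<close> integers from \<open>r - k\<close> to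
  \<open>r k - 1\<close>. Hence \<open>n \<le> (r + 1) (k - 1) + 1\<close> is necessary. It also suffices: for the least such \<open>k\<close>
  we have \<open>k \<le> n\<close>, and the sum at \<open>i\<close> is at least \<open>2 (n - 1 + r) > 1 + k\<close>, so pendant edges never
  cause a conflict.
\<close>

text \<open>Out-arcs of \<open>u\<close> correspond one to one to its neighbors, so the degree is
  absorbed by raising every neighboring label by one.\<close>

lemma d_lucky_sum_with_proj:
  "d_lucky_sum (with_proj G) l u = (\<Sum>v\<in>neighborhood (with_proj G) u. Suc (l v))"
proof -
  have "out_arcs (with_proj G) u = Pair u ` neighborhood (with_proj G) u"
    by (auto simp: out_arcs_def neighborhood_def)
  then have "out_degree (with_proj G) u = card (neighborhood (with_proj G) u)"
    by (simp add: out_degree_def card_image inj_on_def)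
  then show ?thesis
    by (simp add: d_lucky_sum_def sum_Suc)
qed

lemma neighborhood_corona_Inr:
  assumes "i \<in> pverts G" "x \<in> pverts H" "parcs H = {}"
  shows "neighborhood (with_proj (corona G H)) (Inr (i, x)) = {Inl i}"
  using assms by (auto simp: neighborhood_def corona_def)

text \<open>Greedy filling: one element takes \<open>min m K\<close>, and the rest of
  \<open>m\<close> still fits on the remaining elements. It serves to spread a prescribed total over
  the pendants of one center.\<close>

lemma exists_bounded_sum_eq:
  fixes m K :: nat
  assumes "finite A" "m \<le> card A * K"
  shows "\<exists>f. (\<forall>x\<in>A. f x \<le> K) \<and> sum f A = m"
  using assms
proof (induction A arbitrary: m rule: finite_induct)
  case empty
  then show ?case by simp
next
  case (insert a A)
  then have "m - min m K \<le> card A * K"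
    by (auto simp: min_def)
  then obtain f where f: "\<forall>x\<in>A. f x \<le> K" "sum f A = m - min m K"
    using insert.IH by blast
  have "sum (f(a := min m K)) A = sum f A"
    using insert.hyps by (intro sum.cong) auto
  then show ?case
    using f insert.hyps by (intro exI[of _ "f(a := min m K)"]) auto
qed

locale complete_corona_edgeless =
  fixes n r :: nat
    and G :: "'a pair_pre_digraph"
    and H :: "'b pair_pre_digraph"
  assumes two_le_n: "2 \<le> n" and one_le_r: "1 \<le> r"
    and complete: "K\<^bsub>n\<^esub> (with_proj G)"
    and edgeless: "edgeless_digraph r (with_proj H)"
begin

lemma finite_verts: "finite (pverts G)" and card_verts: "card (pverts G) = n"
  and arcs_complete: "parcs G = {(u, v). u \<in> pverts G \<and> v \<in> pverts G \<and> u \<noteq> v}"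
  using complete by (auto simp: complete_digraph_pair_def)

lemma card_pendants: "card (pverts H) = r" and arcs_pendants: "parcs H = {}"
  using edgeless by (auto simp: edgeless_digraph_def)

lemma finite_pendants: "finite (pverts H)"
  using card_pendants one_le_r by (auto intro: card_ge_0_finite)

lemma d_lucky_sum_center:
  assumes "i \<in> pverts G"
  shows "d_lucky_sum (with_proj (corona G H)) l (Inl i) =
    (\<Sum>j\<in>pverts G - {i}. Suc (l (Inl j))) + (\<Sum>x\<in>pverts H. Suc (l (Inr (i, x))))"
proof -
  have "neighborhood (with_proj (corona G H)) (Inl i) =
      Inl ` (pverts G - {i}) \<union> (Inr \<circ> Pair i) ` pverts H"
    using assms
    by (auto simp: neighborhood_def corona_def arcs_complete arcs_pendants)
  then show ?thesis
    using finite_verts finite_pendants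
    by (simp add: d_lucky_sum_with_proj, subst sum.union_disjoint)
      (auto simp: sum.reindex inj_on_def simp del: sum_Suc)
qed

lemma d_lucky_sum_pendant:
  assumes "i \<in> pverts G" "x \<in> pverts H"
  shows "d_lucky_sum (with_proj (corona G H)) l (Inr (i, x)) = Suc (l (Inl i))"
  using assms by (simp add: d_lucky_sum_with_proj neighborhood_corona_Inr arcs_pendants)

text \<open>Adding and subtracting the label of \<open>i\<close> completes the sum to all of
  \<open>pverts G\<close>. Only the last bracket then depends on \<open>i\<close>; it may be
  negative, hence the integers.\<close>

lemma d_lucky_sum_center_int:
  assumes "i \<in> pverts G"
  shows "int (d_lucky_sum (with_proj (corona G H)) l (Inl i)) =
    int (n + r + (\<Sum>j\<in>pverts G. l (Inl j))) - 1
      + (int (\<Sum>x\<in>pverts H. l (Inr (i, x))) - int (l (Inl i)))"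
proof -
  have "(\<Sum>j\<in>pverts G. Suc (l (Inl j))) =
      Suc (l (Inl i)) + (\<Sum>j\<in>pverts G - {i}. Suc (l (Inl j)))"
    using finite_verts assms by (rule sum.remove)
  moreover have "(\<Sum>j\<in>pverts G. Suc (l (Inl j))) = (\<Sum>j\<in>pverts G. l (Inl j)) + n"
    by (simp add: sum_Suc card_verts)
  moreover have "(\<Sum>x\<in>pverts H. Suc (l (Inr (i, x)))) = (\<Sum>x\<in>pverts H. l (Inr (i, x))) + r"
    by (simp add: sum_Suc card_pendants)
  ultimately show ?thesis
    unfolding d_lucky_sum_center[OF assms] by linarith
qed

text \<open>The part common to all centers cancels, which turns the edges between centers into
  injectivity. All pendants of \<open>i\<close> have the same sum, so their edges give a single
  condition.\<close>

lemma d_lucky_labeling_iff: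
  "d_lucky_labeling (with_proj (corona G H)) l \<longleftrightarrow>
    (\<forall>v\<in>pverts (corona G H). 0 < l v) \<and>
    inj_on (\<lambda>i. int (\<Sum>x\<in>pverts H. l (Inr (i, x))) - int (l (Inl i))) (pverts G) \<and>
    (\<forall>i\<in>pverts G. d_lucky_sum (with_proj (corona G H)) l (Inl i) \<noteq> Suc (l (Inl i)))"
  (is "?L \<longleftrightarrow> ?pos \<and> ?inj \<and> ?pend")
proof -
  let ?s = "d_lucky_sum (with_proj (corona G H)) l"
  have s_eq: "?s (Inl i) = ?s (Inl j) \<longleftrightarrow>
      int (\<Sum>x\<in>pverts H. l (Inr (i, x))) - int (l (Inl i)) =
      int (\<Sum>x\<in>pverts H. l (Inr (j, x))) - int (l (Inl j))"
    if "i \<in> pverts G" "j \<in> pverts G" for i j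
    using d_lucky_sum_center_int[OF that(1), of l] d_lucky_sum_center_int[OF that(2), of l]
    by linarith
  \<comment> \<open>A pendant at each center is needed to read \<open>?pend\<close> off the
    edges.\<close>
  obtain x where x: "x \<in> pverts H"
    using card_pendants one_le_r by fastforce
  have "(\<forall>u v. u \<rightarrow>\<^bsub>with_proj (corona G H)\<^esub> v \<longrightarrow> ?s u \<noteq> ?s v) \<longleftrightarrow>
      (\<forall>i\<in>pverts G. \<forall>j\<in>pverts G. i \<noteq> j \<longrightarrow> ?s (Inl i) \<noteq> ?s (Inl j)) \<and> ?pend"
    (is "?edges \<longleftrightarrow> ?center \<and> ?pend")
  proof (intro iffI conjI ballI impI allI)
    fix i j
    assume ?edges "i \<in> pverts G" "j \<in> pverts G" "i \<noteq> j"
    moreover from this have "Inl i \<rightarrow>\<^bsub>with_proj (corona G H)\<^esub> Inl j"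
      by (simp add: corona_def arcs_complete)
    ultimately show "?s (Inl i) \<noteq> ?s (Inl j)"
      by blast
  next
    fix i
    assume ?edges and i: "i \<in> pverts G"
    moreover have "Inl i \<rightarrow>\<^bsub>with_proj (corona G H)\<^esub> Inr (i, x)"
      using i x by (simp add: corona_def)
    ultimately have "?s (Inl i) \<noteq> ?s (Inr (i, x))"
      by blast
    then show "?s (Inl i) \<noteq> Suc (l (Inl i))"
      using i x by (simp add: d_lucky_sum_pendant)
  next
    fix u v
    assume indep: "?center \<and> ?pend" and "u \<rightarrow>\<^bsub>with_proj (corona G H)\<^esub> v"
    then consider
        i j where "u = Inl i" "v = Inl j" "i \<in> pverts G" "j \<in> pverts G" "i \<noteq> j"
      | i y where "u = Inl i" "v = Inr (i, y)" "i \<in> pverts G" "y \<in> pverts H"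
      | i y where "u = Inr (i, y)" "v = Inl i" "i \<in> pverts G" "y \<in> pverts H"
      by (auto simp: corona_def arcs_complete arcs_pendants)
    then show "?s u \<noteq> ?s v"
    proof cases
      case 1
      then show ?thesis using indep by blast
    next
      case 2
      then show ?thesis using indep by (simp add: d_lucky_sum_pendant)
    next
      case 3
      then show ?thesis using indep by (metis d_lucky_sum_pendant)
    qed
  qed
  also have "\<dots> \<longleftrightarrow> ?inj \<and> ?pend"
    using s_eq by (auto simp: inj_on_def)
  finally show ?thesis
    by (simp add: d_lucky_labeling_def)
qed

text \<open>Pigeonhole: \<open>n\<close> distinct integers lie in an interval with
  \<open>(r + 1) * k - r\<close> elements.\<close>

lemma labeling_necessary:
  assumes labels: "l ` pverts (corona G H) \<subseteq> {1..k}"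
    and lucky: "d_lucky_labeling (with_proj (corona G H)) l"
  shows "n + r \<le> (r + 1) * k"
proof -
  let ?w = "\<lambda>i. int (\<Sum>x\<in>pverts H. l (Inr (i, x))) - int (l (Inl i))"
  have bounds: "?w i \<in> {int r - int k..int (r * k) - 1}" if i: "i \<in> pverts G" for i
  proof -
    have pend: "l (Inr (i, x)) \<in> {1..k}" if "x \<in> pverts H" for x
      using labels i that by (auto simp: corona_def image_subset_iff)
    moreover have "l (Inl i) \<in> {1..k}"
      using labels i by (auto simp: corona_def image_subset_iff)
    moreover have "r \<le> (\<Sum>x\<in>pverts H. l (Inr (i, x)))"
      using sum_bounded_below[of "pverts H" 1 "\<lambda>x. l (Inr (i, x))"] pend card_pendants by auto
    moreover have "(\<Sum>x\<in>pverts H. l (Inr (i, x))) \<le> r * k"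
      using sum_bounded_above[of "pverts H" "\<lambda>x. l (Inr (i, x))" k] pend card_pendants by auto
    ultimately show ?thesis
      by (simp del: of_nat_sum of_nat_mult)
  qed
  have "inj_on ?w (pverts G)"
    using lucky d_lucky_labeling_iff by blast
  moreover have "?w ` pverts G \<subseteq> {int r - int k..int (r * k) - 1}"
    using bounds by blast
  ultimately have "card (pverts G) \<le> card {int r - int k..int (r * k) - 1}"
    by (rule card_inj_on_le) simp
  then have "n \<le> nat (int (r * k) + int k - int r)"
    by (simp add: card_verts algebra_simps)
  \<comment> \<open>Since \<open>n\<close> is positive, \<open>nat\<close> has not truncated a
    negative number.\<close>
  then have "int n \<le> int (r * k) + int k - int r"
    using two_le_n by linarith
  then have "int (n + r) \<le> int ((r + 1) * k)"
    by (simp add: algebra_simps)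
  then show ?thesis
    by linarith
qed

lemma labeling_sufficient:
  assumes enough: "n + r \<le> (r + 1) * k" and "k \<le> n"
  shows "\<exists>l. l ` pverts (corona G H) \<subseteq> {1..k} \<and> d_lucky_labeling (with_proj (corona G H)) l"
proof -
  have "0 < k"
    using enough two_le_n by (cases k) auto
  then obtain K where k: "k = Suc K"
    by (cases k) auto
  obtain h where h: "bij_betw h (pverts G) {0..<n}"
    using ex_bij_betw_finite_nat[OF finite_verts] card_verts by auto
  \<comment> \<open>Start from label \<open>k\<close> at the centers and \<open>1\<close> at the
    pendants, where the difference is minimal. It has to grow by \<open>h i\<close>: lowering the
    center label contributes \<open>a i\<close>, and raising pendant labels contributes the
    rest.\<close>
  define a where "a i = min (h i) K" for i
  have "\<exists>f. (\<forall>x\<in>pverts H. f x \<le> K) \<and> sum f (pverts H) = h i - a i" if "i \<in> pverts G" for i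
  proof (rule exists_bounded_sum_eq[OF finite_pendants])
    have "h i < n"
      using h that by (auto simp: bij_betw_def)
    \<comment> \<open>By \<open>enough\<close>, \<open>n - 1 <= (r + 1) * K\<close>; once the center
      has absorbed \<open>K\<close>, at most \<open>r * K\<close> remains.\<close>
    then show "h i - a i \<le> card (pverts H) * K"
      using enough by (auto simp: a_def k card_pendants min_def)
  qed
  then obtain f where f: "\<And>i x. i \<in> pverts G \<Longrightarrow> x \<in> pverts H \<Longrightarrow> f i x \<le> K"
    "\<And>i. i \<in> pverts G \<Longrightarrow> sum (f i) (pverts H) = h i - a i"
    by metis
  \<comment> \<open>Then \<open>p i - l i = r - k + h i\<close>, so these numbers fill an initial part of the possible range.\<close>
  define l where "l = case_sum (\<lambda>i. k - a i) (\<lambda>(i, x). Suc (f i x))"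
  have l_simps: "l (Inl i) = k - a i" "l (Inr (i, x)) = Suc (f i x)" for i x
    by (simp_all add: l_def)
  have a_le: "a i \<le> K" "a i \<le> h i" for i
    by (simp_all add: a_def)
  have range: "l ` pverts (corona G H) \<subseteq> {1..k}"
    using f(1) a_le(1) by (auto simp: corona_def l_simps k Suc_diff_le)
  have w: "int (\<Sum>x\<in>pverts H. l (Inr (i, x))) - int (l (Inl i)) = int r - int k + int (h i)"
    if "i \<in> pverts G" for i
  proof -
    have "(\<Sum>x\<in>pverts H. l (Inr (i, x))) = h i - a i + r"
      using f(2)[OF that] by (simp add: l_simps sum_Suc card_pendants)
    then show ?thesis
      using a_le[of i] by (simp add: l_simps k of_nat_diff)
  qed
  have pos: "\<forall>v\<in>pverts (corona G H). 0 < l v"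
    using range by force
  have "inj_on (\<lambda>i. int r - int k + int (h i)) (pverts G)"
    using h by (auto simp: bij_betw_def inj_on_def)
  then have inj: "inj_on (\<lambda>i. int (\<Sum>x\<in>pverts H. l (Inr (i, x))) - int (l (Inl i))) (pverts G)"
    using w by (simp cong: inj_on_cong)
  have "d_lucky_sum (with_proj (corona G H)) l (Inl i) \<noteq> Suc (l (Inl i))"
    if i: "i \<in> pverts G" for i
  proof -
    have "2 * (n - 1) \<le> (\<Sum>j\<in>pverts G - {i}. Suc (l (Inl j)))"
      using sum_bounded_below[of "pverts G - {i}" 2 "\<lambda>j. Suc (l (Inl j))"] i a_le(1)
      by (simp add: l_simps k card_verts finite_verts mult.commute Suc_diff_le)
    moreover have "2 * r \<le> (\<Sum>x\<in>pverts H. Suc (l (Inr (i, x))))"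
      using sum_bounded_below[of "pverts H" 2 "\<lambda>x. Suc (l (Inr (i, x)))"]
      by (auto simp: card_pendants l_simps)
    moreover have "l (Inl i) \<le> n"
      using \<open>k \<le> n\<close> by (simp add: l_simps)
    \<comment> \<open>The sum at \<open>i\<close> is at least \<open>2 * n\<close>, which exceeds
      \<open>n + 1\<close> because \<open>n >= 2\<close>.\<close>
    ultimately show ?thesis
      using two_le_n one_le_r unfolding d_lucky_sum_center[OF i] by linarith
  qed
  then have "d_lucky_labeling (with_proj (corona G H)) l"
    using pos inj d_lucky_labeling_iff by blast
  with range show ?thesis by blast
qed

lemma d_lucky_number_eq:
  "int (d_lucky_number (with_proj (corona G H))) = \<lceil>(real n + real r) / (real r + 1)\<rceil>"
proof -
  define k where "k = nat \<lceil>(real n + real r) / (real r + 1)\<rceil>"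
  \<comment> \<open>This turns the ceiling into the inequality shared by the two labeling
    lemmas.\<close>
  have le_iff: "k \<le> m \<longleftrightarrow> n + r \<le> (r + 1) * m" for m
  proof -
    have "k \<le> m \<longleftrightarrow> (real n + real r) / (real r + 1) \<le> real m"
      by (simp add: k_def nat_le_iff ceiling_le_iff)
    also have "\<dots> \<longleftrightarrow> real (n + r) \<le> real ((r + 1) * m)"
      by (simp add: divide_le_eq algebra_simps)
    finally show ?thesis
      by (simp only: of_nat_le_iff)
  qed
  have "0 < k"
    using le_iff[of 0] two_le_n by auto
  \<comment> \<open>Through \<open>le_iff\<close>, \<open>k <= n\<close> amounts to
    \<open>n + r <= (r + 1) * n\<close>, that is, \<open>r <= r * n\<close>.\<close>
  have "r * 1 \<le> r * n"
    using two_le_n by (intro mult_le_mono) auto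
  then have "k \<le> n"
    by (simp add: le_iff)
  have "d_lucky_number (with_proj (corona G H)) = k"
    unfolding d_lucky_number_def
  proof (rule Least_equality)
    show "0 < k \<and> (\<exists>l. l ` verts (with_proj (corona G H)) \<subseteq> {1..k} \<and>
        d_lucky_labeling (with_proj (corona G H)) l)"
      using \<open>0 < k\<close> \<open>k \<le> n\<close> labeling_sufficient le_iff[of k] by auto
  next
    fix m
    assume "0 < m \<and> (\<exists>l. l ` verts (with_proj (corona G H)) \<subseteq> {1..m} \<and>
        d_lucky_labeling (with_proj (corona G H)) l)"
    then show "k \<le> m"
      using labeling_necessary le_iff by auto
  qed
  then show ?thesis
    using \<open>0 < k\<close> by (simp add: k_def)
qed

end

theorem theorem2p3:
  fixes n r :: nat
    and G :: "'a pair_pre_digraph"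
    and H :: "'b pair_pre_digraph"
  assumes "n \<ge> 2" and "r \<ge> 1"
    and "K\<^bsub>n\<^esub> (with_proj G)"
    and "edgeless_digraph r (with_proj H)"
  shows "int (d_lucky_number (with_proj (corona G H))) = \<lceil>(real n + real r) / (real r + 1)\<rceil>"
proof -
  interpret complete_corona_edgeless n r G H
    using assms by unfold_locales
  show ?thesis
    by (rule d_lucky_number_eq)
qed

end
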